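(* For every $p>0$ and every integer $N\ge 1$, there exist $N$ distinct points in $\mathbb{R}^3$ carrying equal positive charges, and a line $L\subset\mathbb{R}^3$ disjoint from these points, such that the restriction to $L$ of the potential $V_p$ generated by these charges has exactly $2N-1$ distinct critical points. More precisely, for $N\ge 2$ and any real numbers $a_1<\cdots<a_N$, for all sufficiently small $\epsilon>0$ the function $$V_\epsilon(x)=\sum_{j=1}^N\frac{1}{\big((x-a_j)^2+\epsilon^2\big)^{p/2}},\qquad x\in\mathbb{R},$$ which is the restriction to the $x$-axis of the potential generated by unit charges at the points $(a_j,\epsilon,0)\in\mathbb{R}^3$, has exactly $2N-1$ distinct critical points.
   Context: For points $A_1,\ldots,A_N\in\mathbb{R}^3$ with charges $\zeta_1,\ldots,\zeta_N\in\mathbb{R}$, the generated potential is $V_p(X)=\sum_{j=1}^N \zeta_j|X-A_j|^{-p}$. A critical point of the restriction to a line is a zero of its derivative with respect to an affine coordinate on the line. *)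

theory Defs
  imports "HOL-Analysis.Analysis"
begin

(* At X = A j the corresponding summand is 0 powr (-p) = 0, a junk value; the potential is only
   meant away from the points A 1, ..., A N. *)
definition potential ::
  "real \<Rightarrow> nat \<Rightarrow> (nat \<Rightarrow> real) \<Rightarrow> (nat \<Rightarrow> real ^ 3) \<Rightarrow> real ^ 3 \<Rightarrow> real"
where
  "potential p N \<zeta> A X = (\<Sum>j = 1..N. \<zeta> j * norm (X - A j) powr (- p))"

definition affine_param :: "(real \<Rightarrow> real ^ 3) \<Rightarrow> (real ^ 3) set \<Rightarrow> bool" where
  "affine_param \<gamma> L \<longleftrightarrow> (\<exists>P v. v \<noteq> 0 \<and> \<gamma> = (\<lambda>t. P + t *\<^sub>R v) \<and> range \<gamma> = L)"

definition real_critical_points :: "(real \<Rightarrow> real) \<Rightarrow> real set" where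
  "real_critical_points f = {x. (f has_real_derivative 0) (at x)}"

(* By critical_points_on_eq below, the choice of the affine coordinate is immaterial. *)
definition critical_points_on :: "(real ^ 3) set \<Rightarrow> (real ^ 3 \<Rightarrow> real) \<Rightarrow> (real ^ 3) set" where
  "critical_points_on L f =
     {X. \<exists>\<gamma> t. affine_param \<gamma> L \<and> X = \<gamma> t \<and> t \<in> real_critical_points (f \<circ> \<gamma>)}"

definition V_eps :: "real \<Rightarrow> nat \<Rightarrow> (nat \<Rightarrow> real) \<Rightarrow> real \<Rightarrow> real \<Rightarrow> real" where
  "V_eps p N a \<epsilon> x = (\<Sum>j = 1..N. 1 / ((x - a j)\<^sup>2 + \<epsilon>\<^sup>2) powr (p / 2))"

lemma affine_param_change:
  assumes "affine_param \<gamma> L" "affine_param \<delta> L"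
  obtains c d where "\<delta> = (\<lambda>t. \<gamma> (c + t * d))"
proof -
  obtain P v where g: "v \<noteq> 0" "\<gamma> = (\<lambda>t. P + t *\<^sub>R v)" "range \<gamma> = L"
    using assms(1) unfolding affine_param_def by blast
  obtain Q w where h: "w \<noteq> 0" "\<delta> = (\<lambda>t. Q + t *\<^sub>R w)" "range \<delta> = L"
    using assms(2) unfolding affine_param_def by blast
  have "\<delta> 0 \<in> range \<gamma>" "\<delta> 1 \<in> range \<gamma>"
    using g(3) h(3) by auto
  then obtain c e where "\<delta> 0 = \<gamma> c" "\<delta> 1 = \<gamma> e"
    by blast
  then have c: "Q = P + c *\<^sub>R v" and e: "Q + w = P + e *\<^sub>R v"
    unfolding g(2) h(2) by simp_all
  have "P + c *\<^sub>R v + w = P + e *\<^sub>R v"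
    using c e by simp
  then have "w = (e - c) *\<^sub>R v"
    by (simp add: scaleR_left_diff_distrib algebra_simps)
  then have "\<delta> = (\<lambda>t. \<gamma> (c + t * (e - c)))"
    using c by (simp add: g(2) h(2) scaleR_left_distrib add.assoc)
  then show thesis by (rule that)
qed

lemma critical_points_on_eq:
  assumes "affine_param \<gamma> L"
  shows "critical_points_on L f = \<gamma> ` real_critical_points (f \<circ> \<gamma>)"
proof (intro equalityI subsetI)
  fix X assume "X \<in> critical_points_on L f"
  then obtain \<delta> t where d: "affine_param \<delta> L" "X = \<delta> t"
    and crit: "((f \<circ> \<delta>) has_real_derivative 0) (at t)"
    by (auto simp: critical_points_on_def real_critical_points_def)
  obtain s where s: "\<delta> t = \<gamma> s"
    using d(1) assms unfolding affine_param_def by (metis rangeE rangeI)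
  obtain c e where ce: "\<gamma> = (\<lambda>u. \<delta> (c + u * e))"
    using affine_param_change[OF d(1) assms] .
  have inj: "inj \<delta>"
    using d(1) unfolding affine_param_def by (auto intro!: injI)
  have t: "t = c + s * e"
    using s ce inj by (simp add: inj_eq)
  have "((\<lambda>u. c + u * e) has_real_derivative e) (at s)"
    by (auto intro!: derivative_eq_intros)
  then have "((\<lambda>u. (f \<circ> \<delta>) (c + u * e)) has_real_derivative 0 * e) (at s)"
    using crit unfolding t by (rule DERIV_chain2[rotated])
  then have "s \<in> real_critical_points (f \<circ> \<gamma>)"
    by (simp add: real_critical_points_def ce comp_def)
  then show "X \<in> \<gamma> ` real_critical_points (f \<circ> \<gamma>)"
    using d(2) s by blast
next
  fix X assume "X \<in> \<gamma> ` real_critical_points (f \<circ> \<gamma>)"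
  then show "X \<in> critical_points_on L f"
    using assms unfolding critical_points_on_def by blast
qed

end

theory Submission
  imports Defs "HOL-Real_Asymp.Real_Asymp"
begin

text \<open>
  Write \<open>V\<close> for the potential of \<open>N\<close> unit charges at height \<open>\<epsilon>\<close> over \<open>a 1 < \<dots> < a N\<close>. It is a sum of
  translates of the kernel \<open>u \<mapsto> (u\<^sup>2 + \<epsilon>\<^sup>2) powr (- p / 2)\<close>, which is strictly convex for \<open>\<bar>u\<bar> > w\<close> and
  concave for \<open>\<bar>u\<bar> < w\<close>, where \<open>w = \<epsilon> / sqrt (p + 1)\<close>. As \<open>w\<close> does not depend on the charge, every term is
  convex outside the intervals \<open>[a j - w, a j + w]\<close>. So \<open>V'\<close> has at most one zero in each of the
  \<open>N - 1\<close> gaps between consecutive intervals, and no estimate is required there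
  (\<open>kernel_d2_pos\<close>).

  Inside \<open>[a j - w, a j + w]\<close> the other terms contribute to \<open>V'\<close> and \<open>V''\<close> amounts that are bounded
  uniformly in \<open>\<epsilon>\<close> (\<open>kernel_d1_far\<close>, \<open>kernel_d2_far\<close>), whereas those of the \<open>j\<close>-th term blow up as
  \<open>\<epsilon>\<close> tends to 0. Near the inflection points this fails for \<open>V''\<close>, since the second derivative of the
  \<open>j\<close>-th term vanishes there. The interval is therefore cut at distance \<open>w / 2\<close>: in the outer shell
  the first derivative of the \<open>j\<close>-th term has size \<open>\<epsilon> powr (- p - 1)\<close> and fixes the sign of \<open>V'\<close>
  (\<open>kernel_d1_shell\<close>), in the core its second derivative is below \<open>- c * \<epsilon> powr (- p - 2)\<close> for
  some constant \<open>c > 0\<close> and makes \<open>V'\<close> strictly decreasing (\<open>kernel_d2_core\<close>). So \<open>V'\<close> changes from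
  positive to negative across the interval and has exactly one zero in it.

  The signs at the ends of the intervals then force a zero in each gap as well. To the left of
  \<open>a 1\<close> every term increases and to the right of \<open>a N\<close> every term decreases, so there are
  \<open>N + (N - 1) = 2 * N - 1\<close> zeros in all (\<open>card_zeros_V_d1\<close>).
\<close>

section \<open>Counting zeros with break points\<close>

text \<open>Adjacent closed pieces share a break point, where \<open>f\<close> does not vanish, so no zero is counted twice.
  Finiteness and \<open>t 0 \<le> t n\<close> are included to make the induction go through.\<close>

lemma card_zeros_unique_in_pieces:
  fixes f :: "real \<Rightarrow> real" and t :: "nat \<Rightarrow> real"
  assumes "\<And>i. i \<le> n \<Longrightarrow> f (t i) \<noteq> 0"
    and "\<And>i. i < n \<Longrightarrow> \<exists>!x. x \<in> {t i..t (Suc i)} \<and> f x = 0"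
  shows "finite {x \<in> {t 0..t n}. f x = 0} \<and> card {x \<in> {t 0..t n}. f x = 0} = n \<and> t 0 \<le> t n"
  using assms
proof (induction n)
  case 0
  then have "{x \<in> {t 0..t 0}. f x = 0} = {}" by auto
  then show ?case by (metis (lifting) card.empty finite.emptyI order_refl)
next
  case (Suc n)
  then have IH: "finite {x \<in> {t 0..t n}. f x = 0}" "card {x \<in> {t 0..t n}. f x = 0} = n" "t 0 \<le> t n"
    by auto
  obtain z where z: "z \<in> {t n..t (Suc n)}" "f z = 0"
      "\<And>x. x \<in> {t n..t (Suc n)} \<Longrightarrow> f x = 0 \<Longrightarrow> x = z"
    using Suc.prems(2)[of n] by blast
  have "f (t n) \<noteq> 0" using Suc.prems(1)[of n] by simp
  then have "t n < z" using z(1,2) by (metis atLeastAtMost_iff order_le_less)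
  have "{t 0..t (Suc n)} = {t 0..t n} \<union> {t n..t (Suc n)}"
    using IH(3) z(1) by auto
  then have "{x \<in> {t 0..t (Suc n)}. f x = 0} = insert z {x \<in> {t 0..t n}. f x = 0}"
    using z by blast
  moreover have "z \<notin> {x \<in> {t 0..t n}. f x = 0}" using \<open>t n < z\<close> by simp
  moreover have "t 0 \<le> t (Suc n)" using IH(3) z(1) by simp
  ultimately show ?case using IH by simp
qed

lemma ex1_zero_increasing:
  fixes f f' :: "real \<Rightarrow> real"
  assumes "l < r" "f l < 0" "0 < f r"
    and deriv: "\<And>x. (f has_real_derivative f' x) (at x)"
    and pos: "\<And>x. l < x \<Longrightarrow> x < r \<Longrightarrow> 0 < f' x"
  shows "\<exists>!x. x \<in> {l..r} \<and> f x = 0"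
proof -
  have cont: "continuous_on S f" for S
    using deriv by (meson DERIV_isCont continuous_at_imp_continuous_on)
  have "\<exists>x\<ge>l. x \<le> r \<and> f x = 0"
    using assms by (intro IVT' cont) auto
  moreover have "f x < f y" if "l \<le> x" "x < y" "y \<le> r" for x y
    using that(2)
  proof (rule DERIV_pos_imp_increasing_open)
    show "\<exists>D. (f has_real_derivative D) (at z) \<and> 0 < D" if "x < z" "z < y" for z
      using deriv pos[of z] that \<open>l \<le> x\<close> \<open>y \<le> r\<close> by fastforce
  qed (rule cont)
  ultimately show ?thesis
    by (metis atLeastAtMost_iff less_irrefl linorder_neqE_linordered_idom)
qed

section \<open>The kernel and its derivatives\<close>

definition kernel_d1 :: "real \<Rightarrow> real \<Rightarrow> real \<Rightarrow> real" where
  "kernel_d1 p \<epsilon> u = - p * u * (u\<^sup>2 + \<epsilon>\<^sup>2) powr (- p / 2 - 1)"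

text \<open>
  The factor \<open>(p + 1) * u\<^sup>2 - \<epsilon>\<^sup>2\<close> exhibits the inflection points \<open>\<bar>u\<bar> = \<epsilon> / sqrt (p + 1)\<close>.
\<close>

definition kernel_d2 :: "real \<Rightarrow> real \<Rightarrow> real \<Rightarrow> real" where
  "kernel_d2 p \<epsilon> u = p * ((p + 1) * u\<^sup>2 - \<epsilon>\<^sup>2) * (u\<^sup>2 + \<epsilon>\<^sup>2) powr (- p / 2 - 2)"

lemma powr_lower_exponent:
  fixes q p :: real
  assumes "q > 0"
  shows "q powr (- p / 2 - 1) = q powr (- p / 2 - 2) * q"
proof -
  have "q powr (- p / 2 - 2 + 1) = q powr (- p / 2 - 2) * q"
    unfolding powr_add using assms by simp
  moreover have "- p / 2 - 2 + 1 = - p / 2 - 1" by simp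
  ultimately show ?thesis by metis
qed

lemma kernel_has_derivative:
  assumes "\<epsilon> > 0"
  shows "((\<lambda>x. 1 / ((x - a)\<^sup>2 + \<epsilon>\<^sup>2) powr (p / 2)) has_real_derivative kernel_d1 p \<epsilon> (x - a)) (at x)"
proof -
  have pos: "(y - a)\<^sup>2 + \<epsilon>\<^sup>2 > 0" for y
    using assms by (simp add: add_nonneg_pos)
  have eq: "(\<lambda>x. 1 / ((x - a)\<^sup>2 + \<epsilon>\<^sup>2) powr (p / 2)) = (\<lambda>x. ((x - a)\<^sup>2 + \<epsilon>\<^sup>2) powr (- p / 2))"
    by (simp add: powr_minus_divide)
  show ?thesis
    unfolding eq kernel_d1_def
    by (rule derivative_eq_intros refl | use pos in force)+
qed

lemma kernel_d1_has_derivative: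
  assumes "\<epsilon> > 0"
  shows "((\<lambda>x. kernel_d1 p \<epsilon> (x - a)) has_real_derivative kernel_d2 p \<epsilon> (x - a)) (at x)"
proof -
  have pos: "(y - a)\<^sup>2 + \<epsilon>\<^sup>2 > 0" for y
    using assms by (simp add: add_nonneg_pos)
  have split: "((x - a)\<^sup>2 + \<epsilon>\<^sup>2) powr (- p / 2 - 1)
      = ((x - a)\<^sup>2 + \<epsilon>\<^sup>2) powr (- p / 2 - 2) * ((x - a)\<^sup>2 + \<epsilon>\<^sup>2)"
    by (rule powr_lower_exponent[OF pos])
  have exponent: "- p / 2 - 1 - 1 = - p / 2 - 2" by simp
  have "((\<lambda>x. (x - a)\<^sup>2 + \<epsilon>\<^sup>2) has_real_derivative 2 * (x - a)) (at x)"
    by (auto intro!: derivative_eq_intros)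
  from DERIV_fun_powr[OF this pos, of "- p / 2 - 1"]
  have "((\<lambda>x. ((x - a)\<^sup>2 + \<epsilon>\<^sup>2) powr (- p / 2 - 1)) has_real_derivative
      (- p / 2 - 1) * ((x - a)\<^sup>2 + \<epsilon>\<^sup>2) powr (- p / 2 - 2) * (2 * (x - a))) (at x)"
    unfolding of_nat_1 exponent .
  moreover have "((\<lambda>x. - p * (x - a)) has_real_derivative - p) (at x)"
    by (auto intro!: derivative_eq_intros)
  ultimately have "((\<lambda>x. kernel_d1 p \<epsilon> (x - a)) has_real_derivative
      - p * ((x - a)\<^sup>2 + \<epsilon>\<^sup>2) powr (- p / 2 - 1)
      + (- p / 2 - 1) * ((x - a)\<^sup>2 + \<epsilon>\<^sup>2) powr (- p / 2 - 2) * (2 * (x - a)) * (- p * (x - a))) (at x)"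
    unfolding kernel_d1_def by (rule DERIV_mult[rotated])
  also have "- p * ((x - a)\<^sup>2 + \<epsilon>\<^sup>2) powr (- p / 2 - 1)
      + (- p / 2 - 1) * ((x - a)\<^sup>2 + \<epsilon>\<^sup>2) powr (- p / 2 - 2) * (2 * (x - a)) * (- p * (x - a))
      = kernel_d2 p \<epsilon> (x - a)"
    unfolding split kernel_d2_def by (simp add: field_simps power2_eq_square)
  finally show ?thesis .
qed

lemma kernel_d1_neg: "p > 0 \<Longrightarrow> \<epsilon> > 0 \<Longrightarrow> u > 0 \<Longrightarrow> kernel_d1 p \<epsilon> u < 0"
  by (simp add: kernel_d1_def pos_add_strict)

lemma kernel_d1_minus: "kernel_d1 p \<epsilon> (- u) = - kernel_d1 p \<epsilon> u"
  by (simp add: kernel_d1_def)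

lemma kernel_d1_pos: "p > 0 \<Longrightarrow> \<epsilon> > 0 \<Longrightarrow> u < 0 \<Longrightarrow> kernel_d1 p \<epsilon> u > 0"
  using kernel_d1_neg[of p \<epsilon> "- u"] by (simp add: kernel_d1_minus)

lemma kernel_d2_pos:
  assumes "p > 0" "\<epsilon> > 0" "\<epsilon> / sqrt (p + 1) < \<bar>u\<bar>"
  shows "kernel_d2 p \<epsilon> u > 0"
proof -
  have "(\<epsilon> / sqrt (p + 1))\<^sup>2 < \<bar>u\<bar>\<^sup>2"
    using assms by (intro power_strict_mono) auto
  then have "\<epsilon>\<^sup>2 < (p + 1) * u\<^sup>2"
    using assms(1) by (simp add: power_divide field_simps)
  then show ?thesis
    using assms by (simp add: kernel_d2_def add_nonneg_eq_0_iff)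
qed

text \<open>The bounds at distance at least \<open>r\<close> from the charge must not depend on \<open>\<epsilon>\<close>. Each polynomial factor is
  absorbed into a power of \<open>u\<^sup>2 + \<epsilon>\<^sup>2\<close>, after which \<open>u\<^sup>2 + \<epsilon>\<^sup>2 \<ge> r\<^sup>2\<close> and the negative
  exponent give the claim.\<close>

lemma kernel_d1_far:
  assumes "p > 0" "\<epsilon> > 0" "r > 0" "r \<le> \<bar>u\<bar>"
  shows "\<bar>kernel_d1 p \<epsilon> u\<bar> \<le> p * (r\<^sup>2) powr (- p / 2 - 1 / 2)"
proof -
  let ?q = "u\<^sup>2 + \<epsilon>\<^sup>2"
  have r: "r\<^sup>2 \<le> ?q"
    using assms power_mono[of r "\<bar>u\<bar>" 2] by (simp add: add_increasing2)
  have pos: "?q > 0"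
    using assms by (simp add: add_nonneg_pos)
  have "\<bar>u\<bar> \<le> sqrt ?q"
    using assms by (intro real_le_rsqrt) simp
  then have "\<bar>u\<bar> \<le> ?q powr (1 / 2)"
    using pos by (simp add: powr_half_sqrt)
  then have "\<bar>u\<bar> * ?q powr (- p / 2 - 1) \<le> ?q powr (1 / 2) * ?q powr (- p / 2 - 1)"
    by (intro mult_right_mono) auto
  also have "\<dots> = ?q powr (- p / 2 - 1 / 2)"
    unfolding powr_add[symmetric] by (rule arg_cong[where f = "\<lambda>e. ?q powr e"]) simp
  also have "\<dots> \<le> (r\<^sup>2) powr (- p / 2 - 1 / 2)"
    using assms r by (intro powr_mono2') auto
  finally show ?thesis
    using assms(1) by (simp add: kernel_d1_def abs_mult mult.assoc)
qed

lemma kernel_d2_far: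
  assumes "p > 0" "\<epsilon> > 0" "r > 0" "r \<le> \<bar>u\<bar>"
  shows "kernel_d2 p \<epsilon> u \<le> p * (p + 1) * (r\<^sup>2) powr (- p / 2 - 1)"
proof -
  let ?q = "u\<^sup>2 + \<epsilon>\<^sup>2"
  have r: "r\<^sup>2 \<le> ?q"
    using assms power_mono[of r "\<bar>u\<bar>" 2] by (simp add: add_increasing2)
  have pos: "?q > 0"
    using assms by (simp add: add_nonneg_pos)
  have "(p + 1) * u\<^sup>2 - \<epsilon>\<^sup>2 \<le> (p + 1) * ?q"
    using assms by (simp add: algebra_simps add_increasing2)
  then have "((p + 1) * u\<^sup>2 - \<epsilon>\<^sup>2) * ?q powr (- p / 2 - 2) \<le> (p + 1) * ?q * ?q powr (- p / 2 - 2)"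
    by (intro mult_right_mono) auto
  also have "\<dots> = (p + 1) * ?q powr (- p / 2 - 1)"
    using powr_lower_exponent[OF pos, of p] by simp
  also have "\<dots> \<le> (p + 1) * (r\<^sup>2) powr (- p / 2 - 1)"
    using assms r by (intro mult_left_mono powr_mono2') auto
  finally show ?thesis
    using assms(1) by (simp add: kernel_d2_def mult.assoc)
qed

text \<open>In both estimates near the charge, \<open>\<bar>u\<bar> \<le> \<epsilon>\<close> gives \<open>u\<^sup>2 + \<epsilon>\<^sup>2 \<le> 2 * \<epsilon>\<^sup>2\<close>, which bounds the power
  from below.\<close>

lemma kernel_d1_shell:
  assumes "p > 0" "\<epsilon> > 0" "\<epsilon> / sqrt (p + 1) / 2 \<le> u" "u \<le> \<epsilon> / sqrt (p + 1)"
  shows "kernel_d1 p \<epsilon> u \<le> - p * (\<epsilon> / sqrt (p + 1) / 2) * (2 * \<epsilon>\<^sup>2) powr (- p / 2 - 1)"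
proof -
  have w: "0 < \<epsilon> / sqrt (p + 1)" "\<epsilon> / sqrt (p + 1) \<le> \<epsilon>"
    using assms(1,2) by (auto simp: field_simps)
  have u: "0 < u" "u \<le> \<epsilon>"
    using half_gt_zero[OF w(1)] assms(3) order_trans[OF assms(4) w(2)] by auto
  then have "u\<^sup>2 \<le> \<epsilon>\<^sup>2"
    by (intro power_mono) auto
  then have "(2 * \<epsilon>\<^sup>2) powr (- p / 2 - 1) \<le> (u\<^sup>2 + \<epsilon>\<^sup>2) powr (- p / 2 - 1)"
    using assms by (intro powr_mono2') (auto simp: add_nonneg_pos)
  then have "(\<epsilon> / sqrt (p + 1) / 2) * (2 * \<epsilon>\<^sup>2) powr (- p / 2 - 1) \<le> u * (u\<^sup>2 + \<epsilon>\<^sup>2) powr (- p / 2 - 1)"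
    using assms(3) u by (intro mult_mono) auto
  from mult_left_mono[OF this, of p] show ?thesis
    using assms(1) by (simp add: kernel_d1_def mult.assoc)
qed

text \<open>Staying at half the inflection distance leaves the factor \<open>\<epsilon>\<^sup>2 - (p + 1) * u\<^sup>2\<close> at least
  \<open>3 / 4 * \<epsilon>\<^sup>2\<close>.\<close>

lemma kernel_d2_core:
  assumes "p > 0" "\<epsilon> > 0" "\<bar>u\<bar> \<le> \<epsilon> / sqrt (p + 1) / 2"
  shows "kernel_d2 p \<epsilon> u \<le> - p * (3 / 4 * \<epsilon>\<^sup>2) * (2 * \<epsilon>\<^sup>2) powr (- p / 2 - 2)"
proof -
  have "\<bar>u\<bar>\<^sup>2 \<le> (\<epsilon> / sqrt (p + 1) / 2)\<^sup>2"
    using assms by (intro power_mono) auto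
  then have u: "(p + 1) * u\<^sup>2 \<le> \<epsilon>\<^sup>2 / 4"
    using assms(1) by (simp add: power_divide field_simps)
  have "u\<^sup>2 \<le> (p + 1) * u\<^sup>2"
    using assms(1) by (simp add: algebra_simps)
  then have "u\<^sup>2 \<le> \<epsilon>\<^sup>2"
    using u zero_le_power2[of \<epsilon>] by linarith
  then have "(2 * \<epsilon>\<^sup>2) powr (- p / 2 - 2) \<le> (u\<^sup>2 + \<epsilon>\<^sup>2) powr (- p / 2 - 2)"
    using assms by (intro powr_mono2') (auto simp: add_nonneg_pos)
  then have "(3 / 4 * \<epsilon>\<^sup>2) * (2 * \<epsilon>\<^sup>2) powr (- p / 2 - 2)
      \<le> (\<epsilon>\<^sup>2 - (p + 1) * u\<^sup>2) * (u\<^sup>2 + \<epsilon>\<^sup>2) powr (- p / 2 - 2)"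
    using u zero_le_power2[of \<epsilon>] by (intro mult_mono) (linarith | simp)+
  from mult_left_mono[OF this, of p] show ?thesis
    using assms(1) by (simp add: kernel_d2_def algebra_simps)
qed

text \<open>Up to constants the two right-hand sides are \<open>\<epsilon> powr (- p - 1)\<close> and \<open>\<epsilon> powr (- p - 2)\<close>.\<close>

lemma eventually_kernel_dominates:
  assumes "p > 0"
  shows "eventually (\<lambda>\<epsilon>. C < p * (\<epsilon> / sqrt (p + 1) / 2) * (2 * \<epsilon>\<^sup>2) powr (- p / 2 - 1)) (at_right 0)"
    and "eventually (\<lambda>\<epsilon>. C < p * (3 / 4 * \<epsilon>\<^sup>2) * (2 * \<epsilon>\<^sup>2) powr (- p / 2 - 2)) (at_right 0)"
proof -
  define s where "s = sqrt (p + 1)"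
  have s: "s > 0" using assms by (simp add: s_def)
  have "filterlim (\<lambda>\<epsilon>. p * (\<epsilon> / s / 2) * (2 * \<epsilon>\<^sup>2) powr (- p / 2 - 1)) at_top (at_right 0)"
    using assms s by real_asymp
  then show "eventually (\<lambda>\<epsilon>. C < p * (\<epsilon> / sqrt (p + 1) / 2) * (2 * \<epsilon>\<^sup>2) powr (- p / 2 - 1)) (at_right 0)"
    unfolding s_def by (rule filterlim_at_top_dense[THEN iffD1, rule_format])
  have "filterlim (\<lambda>\<epsilon>. p * (3 / 4 * \<epsilon>\<^sup>2) * (2 * \<epsilon>\<^sup>2) powr (- p / 2 - 2)) at_top (at_right 0)"
    using assms by real_asymp
  then show "eventually (\<lambda>\<epsilon>. C < p * (3 / 4 * \<epsilon>\<^sup>2) * (2 * \<epsilon>\<^sup>2) powr (- p / 2 - 2)) (at_right 0)"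
    by (rule filterlim_at_top_dense[THEN iffD1, rule_format])
qed

section \<open>Critical points of the sum\<close>

definition V_d1 :: "real \<Rightarrow> nat \<Rightarrow> (nat \<Rightarrow> real) \<Rightarrow> real \<Rightarrow> real \<Rightarrow> real" where
  "V_d1 p N a \<epsilon> x = (\<Sum>j = 1..N. kernel_d1 p \<epsilon> (x - a j))"

definition V_d2 :: "real \<Rightarrow> nat \<Rightarrow> (nat \<Rightarrow> real) \<Rightarrow> real \<Rightarrow> real \<Rightarrow> real" where
  "V_d2 p N a \<epsilon> x = (\<Sum>j = 1..N. kernel_d2 p \<epsilon> (x - a j))"

lemma V_d1_has_derivative:
  assumes "\<epsilon> > 0"
  shows "(V_d1 p N a \<epsilon> has_real_derivative V_d2 p N a \<epsilon> x) (at x)"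
  unfolding V_d1_def V_d2_def by (intro DERIV_sum kernel_d1_has_derivative assms)

lemma real_critical_points_V_eps:
  assumes "\<epsilon> > 0"
  shows "real_critical_points (V_eps p N a \<epsilon>) = {x. V_d1 p N a \<epsilon> x = 0}"
proof -
  have "(V_eps p N a \<epsilon> has_real_derivative V_d1 p N a \<epsilon> x) (at x)" for x
    using DERIV_sum[of "{1..N}" "\<lambda>x j. 1 / ((x - a j)\<^sup>2 + \<epsilon>\<^sup>2) powr (p / 2)"
        "\<lambda>j. kernel_d1 p \<epsilon> (x - a j)" "at x"] kernel_has_derivative[OF assms]
    unfolding V_d1_def V_eps_def by blast
  then show ?thesis
    unfolding real_critical_points_def by (metis DERIV_unique)
qed

lemma sum_le_term_plus_bound:
  fixes f :: "nat \<Rightarrow> real"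
  assumes "j \<in> {1..N}" "\<And>k. k \<in> {1..N} \<Longrightarrow> k \<noteq> j \<Longrightarrow> f k \<le> C" "0 \<le> C"
  shows "(\<Sum>k = 1..N. f k) \<le> f j + real N * C"
proof -
  have "(\<Sum>k = 1..N. f k) = f j + sum f ({1..N} - {j})"
    using assms(1) by (simp add: sum.remove)
  moreover have "sum f ({1..N} - {j}) \<le> real (card ({1..N} - {j})) * C"
    using assms(2) by (intro sum_bounded_above) auto
  moreover have "real (card ({1..N} - {j})) * C \<le> real N * C"
    using assms by (intro mult_right_mono) auto
  ultimately show ?thesis by simp
qed

text \<open>The hypotheses \<open>dom1\<close> and \<open>dom2\<close> say that the charge nearest to a point of the shell or core outweighs
  all the others, which are at distance at least \<open>d / 2\<close> because \<open>w \<le> \<epsilon> < d / 2\<close>.\<close>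

lemma card_zeros_V_d1:
  fixes p d \<epsilon> :: real and N :: nat and a :: "nat \<Rightarrow> real"
  defines "w \<equiv> \<epsilon> / sqrt (p + 1)"
  assumes p: "p > 0" and N: "N \<ge> 1" and d: "d > 0"
    and sep: "\<And>j k. j \<in> {1..N} \<Longrightarrow> k \<in> {1..N} \<Longrightarrow> j < k \<Longrightarrow> a j + d \<le> a k"
    and \<epsilon>: "\<epsilon> > 0" "\<epsilon> < d / 2"
    and dom1: "real N * (p * ((d / 2)\<^sup>2) powr (- p / 2 - 1 / 2))
        < p * (\<epsilon> / sqrt (p + 1) / 2) * (2 * \<epsilon>\<^sup>2) powr (- p / 2 - 1)"
    and dom2: "real N * (p * (p + 1) * ((d / 2)\<^sup>2) powr (- p / 2 - 1))
        < p * (3 / 4 * \<epsilon>\<^sup>2) * (2 * \<epsilon>\<^sup>2) powr (- p / 2 - 2)"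
  shows "card {x. V_d1 p N a \<epsilon> x = 0} = 2 * N - 1"
proof -
  let ?D = "V_d1 p N a \<epsilon>"
  have w: "0 < w" "w \<le> \<epsilon>"
    using p \<epsilon> by (auto simp: w_def field_simps)
  have far: "d / 2 \<le> \<bar>x - a k\<bar>"
    if "j \<in> {1..N}" "k \<in> {1..N}" "k \<noteq> j" "\<bar>x - a j\<bar> \<le> w" for j k x
    using sep[of j k] sep[of k j] that w \<epsilon> by (cases "j < k") (auto simp: abs_if split: if_splits)
  have right: "?D x < 0" if "j \<in> {1..N}" "a j + w / 2 \<le> x" "x \<le> a j + w" for j x
  proof -
    have "?D x \<le> kernel_d1 p \<epsilon> (x - a j) + real N * (p * ((d / 2)\<^sup>2) powr (- p / 2 - 1 / 2))"
      unfolding V_d1_def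
    proof (rule sum_le_term_plus_bound[OF that(1)])
      show "kernel_d1 p \<epsilon> (x - a k) \<le> p * ((d / 2)\<^sup>2) powr (- p / 2 - 1 / 2)"
        if "k \<in> {1..N}" "k \<noteq> j" for k
        using kernel_d1_far[OF p \<epsilon>(1), of "d / 2" "x - a k"] far[OF \<open>j \<in> {1..N}\<close> that, of x] d w
          \<open>a j + w / 2 \<le> x\<close> \<open>x \<le> a j + w\<close> by fastforce
    qed (use p in simp)
    moreover have "kernel_d1 p \<epsilon> (x - a j) \<le> - p * (\<epsilon> / sqrt (p + 1) / 2) * (2 * \<epsilon>\<^sup>2) powr (- p / 2 - 1)"
      using that by (intro kernel_d1_shell p \<epsilon>(1)) (auto simp: w_def)
    ultimately show ?thesis using dom1 by simp
  qed
  have left: "0 < ?D x" if "j \<in> {1..N}" "a j - w \<le> x" "x \<le> a j - w / 2" for j x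
  proof -
    have "- ?D x \<le> - kernel_d1 p \<epsilon> (x - a j) + real N * (p * ((d / 2)\<^sup>2) powr (- p / 2 - 1 / 2))"
      unfolding V_d1_def sum_negf[symmetric]
    proof (rule sum_le_term_plus_bound[OF that(1)])
      show "- kernel_d1 p \<epsilon> (x - a k) \<le> p * ((d / 2)\<^sup>2) powr (- p / 2 - 1 / 2)"
        if "k \<in> {1..N}" "k \<noteq> j" for k
        using kernel_d1_far[OF p \<epsilon>(1), of "d / 2" "x - a k"] far[OF \<open>j \<in> {1..N}\<close> that, of x] d w
          \<open>a j - w \<le> x\<close> \<open>x \<le> a j - w / 2\<close> by fastforce
    qed (use p in simp)
    moreover have "kernel_d1 p \<epsilon> (- (x - a j)) \<le> - p * (\<epsilon> / sqrt (p + 1) / 2) * (2 * \<epsilon>\<^sup>2) powr (- p / 2 - 1)"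
      using that by (intro kernel_d1_shell p \<epsilon>(1)) (auto simp: w_def)
    ultimately show ?thesis using dom1 by (simp add: kernel_d1_minus del: minus_diff_eq)
  qed
  have core: "V_d2 p N a \<epsilon> x < 0" if "j \<in> {1..N}" "\<bar>x - a j\<bar> \<le> w / 2" for j x
  proof -
    have "V_d2 p N a \<epsilon> x \<le> kernel_d2 p \<epsilon> (x - a j)
        + real N * (p * (p + 1) * ((d / 2)\<^sup>2) powr (- p / 2 - 1))"
      unfolding V_d2_def
    proof (rule sum_le_term_plus_bound[OF that(1)])
      show "kernel_d2 p \<epsilon> (x - a k) \<le> p * (p + 1) * ((d / 2)\<^sup>2) powr (- p / 2 - 1)"
        if "k \<in> {1..N}" "k \<noteq> j" for k
        using kernel_d2_far[OF p \<epsilon>(1), of "d / 2" "x - a k"] far[OF \<open>j \<in> {1..N}\<close> that, of x] d w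
          \<open>\<bar>x - a j\<bar> \<le> w / 2\<close> by fastforce
    qed (use p in simp)
    moreover have "kernel_d2 p \<epsilon> (x - a j) \<le> - p * (3 / 4 * \<epsilon>\<^sup>2) * (2 * \<epsilon>\<^sup>2) powr (- p / 2 - 2)"
      using that by (intro kernel_d2_core p \<epsilon>(1)) (auto simp: w_def)
    ultimately show ?thesis using dom2 by simp
  qed
  have near: "\<exists>!x. x \<in> {a j - w..a j + w} \<and> ?D x = 0" if j: "j \<in> {1..N}" for j
  proof -
    have "\<exists>!x. x \<in> {a j - w / 2..a j + w / 2} \<and> - ?D x = 0"
    proof (rule ex1_zero_increasing)
      show "((\<lambda>x. - ?D x) has_real_derivative - V_d2 p N a \<epsilon> x) (at x)" for x
        by (intro DERIV_minus V_d1_has_derivative \<epsilon>)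
      show "0 < - V_d2 p N a \<epsilon> x" if "a j - w / 2 < x" "x < a j + w / 2" for x
      proof -
        have "\<bar>x - a j\<bar> \<le> w / 2" using that by linarith
        then show ?thesis using core[OF j] by simp
      qed
    qed (use w left[OF j, of "a j - w / 2"] right[OF j, of "a j + w / 2"] in auto)
    moreover have "x \<in> {a j - w..a j + w} \<and> ?D x = 0 \<longleftrightarrow> x \<in> {a j - w / 2..a j + w / 2} \<and> - ?D x = 0" for x
      using left[OF j, of x] right[OF j, of x] w by force
    ultimately show ?thesis by simp
  qed
  have order: "a j \<le> a k" if "j \<in> {1..N}" "k \<in> {1..N}" "j \<le> k" for j k
    using sep[of j k] that d by (cases "j = k") auto
  have gap: "\<exists>!x. x \<in> {a j + w..a (Suc j) - w} \<and> ?D x = 0" if j: "j \<in> {1..N}" "Suc j \<in> {1..N}" for j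
  proof (rule ex1_zero_increasing[OF _ _ _ V_d1_has_derivative[OF \<epsilon>(1)]])
    show "a j + w < a (Suc j) - w"
      using sep[OF j] w \<epsilon> by simp
    show "?D (a j + w) < 0" "0 < ?D (a (Suc j) - w)"
      using right[OF j(1), of "a j + w"] left[OF j(2), of "a (Suc j) - w"] w by auto
    show "0 < V_d2 p N a \<epsilon> x" if x: "a j + w < x" "x < a (Suc j) - w" for x
      unfolding V_d2_def
    proof (rule sum_pos)
      show "0 < kernel_d2 p \<epsilon> (x - a k)" if k: "k \<in> {1..N}" for k
      proof (rule kernel_d2_pos[OF p \<epsilon>(1)])
        have "a k \<le> a j \<or> a (Suc j) \<le> a k"
          using order[of k j] order[of "Suc j" k] j k by (cases "k \<le> j") auto
        then show "\<epsilon> / sqrt (p + 1) < \<bar>x - a k\<bar>"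
          using x w unfolding w_def[symmetric] by auto
      qed
    qed (use N in auto)
  qed
  \<comment> \<open>The \<open>2 * N\<close> break points \<open>a 1 - w, a 1 + w, \<dots>, a N - w, a N + w\<close>, numbered from 0.\<close>
  define t where "t i = (if even i then a (i div 2 + 1) - w else a (i div 2 + 1) + w)" for i
  have outside: "x \<in> {t 0..t (2 * N - 1)}" if "?D x = 0" for x
  proof -
    have "\<not> x < a 1"
    proof
      assume "x < a 1"
      then have "0 < ?D x"
        unfolding V_d1_def using order[of 1] N
        by (intro sum_pos kernel_d1_pos p \<epsilon>(1)) (auto, fastforce)
      with that show False by simp
    qed
    moreover have "\<not> a N < x"
    proof
      assume "a N < x"
      then have "0 < - ?D x"
        unfolding V_d1_def sum_negf[symmetric] using order[of _ N] N
        by (intro sum_pos) (auto intro!: kernel_d1_neg p \<epsilon>(1), fastforce)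
      with that show False by simp
    qed
    moreover have "t 0 = a 1 - w"
      by (simp add: t_def)
    moreover have "t (2 * N - 1) = a N + w"
    proof -
      obtain M where "N = Suc M" using N by (cases N) auto
      then show ?thesis by (simp add: t_def)
    qed
    ultimately show ?thesis using w by auto
  qed
  have "card {x \<in> {t 0..t (2 * N - 1)}. ?D x = 0} = 2 * N - 1"
  proof (rule card_zeros_unique_in_pieces[THEN conjunct2, THEN conjunct1])
    fix i assume "i \<le> 2 * N - 1"
    then have "i div 2 + 1 \<in> {1..N}" using N by auto
    then show "?D (t i) \<noteq> 0"
      using left[of "i div 2 + 1" "t i"] right[of "i div 2 + 1" "t i"] w
      by (cases "even i") (auto simp: t_def)
  next
    fix i assume i: "i < 2 * N - 1"
    show "\<exists>!x. x \<in> {t i..t (Suc i)} \<and> ?D x = 0"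
    proof (cases "even i")
      case True
      then show ?thesis using near[of "i div 2 + 1"] i by (auto simp: t_def)
    next
      case False
      then obtain m where m: "i = 2 * m + 1" by (auto elim: oddE)
      then have "m + 1 \<in> {1..N}" "Suc (m + 1) \<in> {1..N}" using i by auto
      from gap[OF this] show ?thesis by (simp add: t_def m)
    qed
  qed
  moreover have "{x \<in> {t 0..t (2 * N - 1)}. ?D x = 0} = {x. ?D x = 0}"
    using outside by auto
  ultimately show ?thesis by simp
qed

text \<open>The element 1 keeps the set of differences nonempty when there is at most one point.\<close>

lemma strict_mono_on_imp_separated:
  fixes a :: "nat \<Rightarrow> real"
  assumes "strict_mono_on {1..N} a"
  obtains d where "d > 0" "\<And>j k. j \<in> {1..N} \<Longrightarrow> k \<in> {1..N} \<Longrightarrow> j < k \<Longrightarrow> a j + d \<le> a k"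
proof -
  let ?S = "insert 1 ((\<lambda>(j, k). a k - a j) ` {(j, k) \<in> {1..N} \<times> {1..N}. j < k})"
  have fin: "finite ?S"
    by (intro finite.insertI finite_imageI) (rule finite_subset[of _ "{1..N} \<times> {1..N}"], auto)
  have "0 < Min ?S"
    using fin assms by (subst Min_gr_iff) (auto simp: strict_mono_on_def)
  moreover have "a j + Min ?S \<le> a k" if "j \<in> {1..N}" "k \<in> {1..N}" "j < k" for j k
  proof -
    have "a k - a j \<in> ?S" using that by force
    then have "Min ?S \<le> a k - a j" using fin by (rule Min_le[rotated])
    then show ?thesis by simp
  qed
  ultimately show thesis using that by blast
qed

lemma eventually_card_critical_points_V_eps:
  fixes p :: real and a :: "nat \<Rightarrow> real"
  assumes "p > 0" "N \<ge> 1" "strict_mono_on {1..N} a"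
  shows "\<exists>\<epsilon>\<^sub>0>0. \<forall>\<epsilon>. 0 < \<epsilon> \<and> \<epsilon> < \<epsilon>\<^sub>0 \<longrightarrow> card (real_critical_points (V_eps p N a \<epsilon>)) = 2 * N - 1"
proof -
  obtain d where d: "d > 0" "\<And>j k. j \<in> {1..N} \<Longrightarrow> k \<in> {1..N} \<Longrightarrow> j < k \<Longrightarrow> a j + d \<le> a k"
    using strict_mono_on_imp_separated[OF assms(3)] by metis
  have "eventually (\<lambda>\<epsilon>. \<epsilon> \<in> {0<..<d / 2}) (at_right 0)"
    using d(1) by (intro eventually_at_right_real) simp
  then have "eventually (\<lambda>\<epsilon>. card (real_critical_points (V_eps p N a \<epsilon>)) = 2 * N - 1) (at_right 0)"
    using eventually_kernel_dominates(1)[OF assms(1), of "real N * (p * ((d / 2)\<^sup>2) powr (- p / 2 - 1 / 2))"]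
      eventually_kernel_dominates(2)[OF assms(1), of "real N * (p * (p + 1) * ((d / 2)\<^sup>2) powr (- p / 2 - 1))"]
  proof eventually_elim
    case (elim \<epsilon>)
    then have "card {x. V_d1 p N a \<epsilon> x = 0} = 2 * N - 1"
      by (intro card_zeros_V_d1[OF assms(1,2) d]) auto
    then show ?case
      using elim(1) by (simp add: real_critical_points_V_eps)
  qed
  then show ?thesis
    unfolding eventually_at_right_field by blast
qed

section \<open>Passage to the line in space\<close>

lemma potential_on_axis:
  "potential p N (\<lambda>j. 1) (\<lambda>j. vector [a j, \<epsilon>, 0]) (vector [x, 0, 0]) = V_eps p N a \<epsilon> x"
proof -
  have "norm (vector [x, 0, 0] - vector [b, \<epsilon>, 0] :: real ^ 3) powr (- p)
      = 1 / ((x - b)\<^sup>2 + \<epsilon>\<^sup>2) powr (p / 2)" for b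
  proof -
    have "norm (vector [x, 0, 0] - vector [b, \<epsilon>, 0] :: real ^ 3) = sqrt ((x - b)\<^sup>2 + \<epsilon>\<^sup>2)"
      by (simp add: norm_vec_def L2_set_def sum_3)
    also have "\<dots> = ((x - b)\<^sup>2 + \<epsilon>\<^sup>2) powr (1 / 2)"
      by (simp add: powr_half_sqrt)
    finally show ?thesis
      by (simp add: powr_powr powr_minus_divide)
  qed
  then show ?thesis
    by (simp add: potential_def V_eps_def)
qed

lemma axis_line:
  defines "L \<equiv> range (\<lambda>x. vector [x, 0, 0] :: real ^ 3)"
  shows "affine_param (\<lambda>x. vector [x, 0, 0]) L" "affine L" "aff_dim L = 1"
proof -
  let ?v = "vector [1, 0, 0] :: real ^ 3"
  have v: "?v \<noteq> 0"
    by (simp add: vec_eq_iff forall_3)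
  have eq: "(\<lambda>x. vector [x, 0, 0] :: real ^ 3) = (\<lambda>x. 0 + x *\<^sub>R ?v)"
    by (simp add: fun_eq_iff vec_eq_iff forall_3)
  show "affine_param (\<lambda>x. vector [x, 0, 0]) L"
    unfolding affine_param_def L_def using v eq by blast
  have L: "L = span {?v}"
    unfolding L_def eq by (simp add: span_singleton)
  show "affine L"
    unfolding L by (intro subspace_imp_affine subspace_span)
  show "aff_dim L = 1"
    unfolding L using v by (simp add: aff_dim_subspace)
qed

theorem mainTheorem3:
  fixes p :: real
  assumes "p > 0"
  shows
    "(\<forall>N::nat. N \<ge> 1 \<longrightarrow>
        (\<exists>(A :: nat \<Rightarrow> real ^ 3) (q :: real) (L :: (real ^ 3) set).
           inj_on A {1..N} \<and> q > 0 \<and>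
           affine L \<and> aff_dim L = 1 \<and> L \<inter> A ` {1..N} = {} \<and>
           card (critical_points_on L (potential p N (\<lambda>j. q) A)) = 2 * N - 1))
     \<and>
     (\<forall>(N::nat) (a :: nat \<Rightarrow> real). N \<ge> 2 \<and> strict_mono_on {1..N} a \<longrightarrow>
        (\<forall>\<epsilon>>0. \<forall>x. potential p N (\<lambda>j. 1) (\<lambda>j. vector [a j, \<epsilon>, 0]) (vector [x, 0, 0])
                      = V_eps p N a \<epsilon> x) \<and>
        (\<exists>\<epsilon>\<^sub>0>0. \<forall>\<epsilon>. 0 < \<epsilon> \<and> \<epsilon> < \<epsilon>\<^sub>0 \<longrightarrow>
           card (real_critical_points (V_eps p N a \<epsilon>)) = 2 * N - 1))"
proof (intro conjI allI impI)
  fix N :: nat assume N: "N \<ge> 1"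
  have "strict_mono_on {1..N} real"
    by (simp add: strict_mono_on_def)
  then obtain \<epsilon>\<^sub>0 where \<epsilon>\<^sub>0: "\<epsilon>\<^sub>0 > 0"
    "\<And>\<epsilon>. 0 < \<epsilon> \<and> \<epsilon> < \<epsilon>\<^sub>0 \<Longrightarrow> card (real_critical_points (V_eps p N real \<epsilon>)) = 2 * N - 1"
    using eventually_card_critical_points_V_eps[OF assms N] by blast
  define \<epsilon> where "\<epsilon> = \<epsilon>\<^sub>0 / 2"
  have \<epsilon>: "\<epsilon> > 0" "card (real_critical_points (V_eps p N real \<epsilon>)) = 2 * N - 1"
    using \<epsilon>\<^sub>0 by (auto simp: \<epsilon>_def)
  let ?\<gamma> = "\<lambda>x. vector [x, 0, 0] :: real ^ 3"
  let ?A = "\<lambda>j. vector [real j, \<epsilon>, 0] :: real ^ 3"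
  have inj: "inj ?\<gamma>" "inj_on ?A {1..N}"
    by (auto simp: inj_on_def vec_eq_iff forall_3)
  have disjoint: "range ?\<gamma> \<inter> ?A ` {1..N} = {}"
    using \<epsilon>(1) by (auto simp: vec_eq_iff forall_3)
  have "potential p N (\<lambda>j. 1) ?A \<circ> ?\<gamma> = V_eps p N real \<epsilon>"
    by (simp add: fun_eq_iff potential_on_axis)
  then have "card (critical_points_on (range ?\<gamma>) (potential p N (\<lambda>j. 1) ?A)) = 2 * N - 1"
    using \<epsilon>(2) inj(1) by (simp add: critical_points_on_eq[OF axis_line(1)] card_image inj_on_subset)
  then show "\<exists>(A :: nat \<Rightarrow> real ^ 3) (q :: real) (L :: (real ^ 3) set).
           inj_on A {1..N} \<and> q > 0 \<and>
           affine L \<and> aff_dim L = 1 \<and> L \<inter> A ` {1..N} = {} \<and>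
           card (critical_points_on L (potential p N (\<lambda>j. q) A)) = 2 * N - 1"
    using inj(2) disjoint axis_line(2,3) by (intro exI[of _ ?A] exI[of _ "1::real"] exI[of _ "range ?\<gamma>"]) simp
next
  fix N :: nat and a :: "nat \<Rightarrow> real" and \<epsilon> x :: real
  show "potential p N (\<lambda>j. 1) (\<lambda>j. vector [a j, \<epsilon>, 0]) (vector [x, 0, 0]) = V_eps p N a \<epsilon> x"
    by (rule potential_on_axis)
next
  fix N :: nat and a :: "nat \<Rightarrow> real" assume "N \<ge> 2 \<and> strict_mono_on {1..N} a"
  then show "\<exists>\<epsilon>\<^sub>0>0. \<forall>\<epsilon>. 0 < \<epsilon> \<and> \<epsilon> < \<epsilon>\<^sub>0 \<longrightarrow>
           card (real_critical_points (V_eps p N a \<epsilon>)) = 2 * N - 1"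
    using eventually_card_critical_points_V_eps[OF assms] by simp
qed

end
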